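(* Let $d>2$, $n,H\ge1$, and let $(\mathcal Z,\mathcal C)$ be a random Xavier initialization of the depth-$d$ network with $H$ hidden units per layer and input dimension $n$. With high probability over the draw of the initialization, for all parameters $(\mathcal W,\mathcal B)$ of the network, $$\prod_{k=1}^d\|\vec W_k\|_2\ \le\ \tilde{\mathcal O}\Big(c^d\big(1+\|(\mathcal W,\mathcal B)-(\mathcal Z,\mathcal C)\|_F\big)^d\Big)$$ for some $c=\tilde{\mathcal O}(1)$.
   Context: Parameters: $\mathcal W=\{\vec W_1,\dots,\vec W_d\}$ and $\mathcal B=\{\vec b_1,\dots,\vec b_d\}$ with $\vec W_1\in\mathbb R^{H\times n}$, $\vec W_k\in\mathbb R^{H\times H}$ for $1<k<d$, $\vec W_d\in\mathbb R^{1\times H}$, $\vec b_k\in\mathbb R^H$ for $k<d$, $\vec b_d\in\mathbb R$. Xavier initialization: $(\mathcal Z,\mathcal C)$ has the same shapes as $(\mathcal W,\mathcal B)$; all entries of the matrices $\vec Z_k$ are independent centered Gaussians with standard deviation $\Theta(1/\sqrt H)$ (between $a_1/\sqrt H$ and $a_2/\sqrt H$ for fixed constants $0<a_1\le a_2$, with a common value within each layer), and all biases $\vec c_k$ in $\mathcal C$ are $0$. $\|\cdot\|_2$ is the spectral norm, $\|\cdot\|_F$ on matrices the Frobenius norm, and $\|(\mathcal W,\mathcal B)-(\mathcal Z,\mathcal C)\|_F=\sqrt{\sum_{k=1}^d\|\vec W_k-\vec Z_k\|_F^2+\|\vec b_k-\vec c_k\|^2}$. "With high probability" means with probability at least $1-\delta$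 for any given $\delta\in(0,1)$; $\tilde{\mathcal O}$ hides constants and factors polylogarithmic in $H,d,1/\delta$. The input dimension $n$ and $a_1,a_2$ are regarded as fixed, so hidden constants may depend on them, but not on $H,d$ or $(\mathcal W,\mathcal B)$. *)

theory Defs
  imports "HOL-Probability.Probability" "Jordan_Normal_Form.Matrix"
begin

definition vec_norm2 :: "real Matrix.vec \<Rightarrow> real" where
  "vec_norm2 v = L2_set (vec_index v) {..<dim_vec v}"

definition frobenius_norm :: "real Matrix.mat \<Rightarrow> real" where
  "frobenius_norm A = L2_set (index_mat A) ({..<dim_row A} \<times> {..<dim_col A})"

definition spectral_norm :: "real Matrix.mat \<Rightarrow> real" where
  "spectral_norm A =
     (SUP x \<in> {x \<in> carrier_vec (dim_col A). vec_norm2 x \<le> 1}. vec_norm2 (A *\<^sub>v x))"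

text \<open>
  Parameters of a network with \<open>d\<close> layers, \<open>H\<close> hidden units per layer, input dimension \<open>n\<close>
  and scalar output: weight matrices and bias vectors, of which only those with index in
  \<open>{1..d}\<close> matter. The last bias, a real number, is a vector of dimension 1.
\<close>

type_synonym params = "(nat \<Rightarrow> real Matrix.mat) \<times> (nat \<Rightarrow> real Matrix.vec)"

definition layer_rows :: "nat \<Rightarrow> nat \<Rightarrow> nat \<Rightarrow> nat" where
  "layer_rows H d k = (if k = d then 1 else H)"

definition layer_cols :: "nat \<Rightarrow> nat \<Rightarrow> nat \<Rightarrow> nat" where
  "layer_cols n H k = (if k = 1 then n else H)"

definition network_params :: "nat \<Rightarrow> nat \<Rightarrow> nat \<Rightarrow> params set" where
  "network_params n H d =
     {(W, B). \<forall>k\<in>{1..d}. W k \<in> carrier_mat (layer_rows H d k) (layer_cols n H k) \<and>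
                          B k \<in> carrier_vec (layer_rows H d k)}"

fun params_dist :: "nat \<Rightarrow> params \<Rightarrow> params \<Rightarrow> real" where
  "params_dist d (W, B) (Z, C) =
     sqrt (\<Sum>k=1..d. (frobenius_norm (W k - Z k))\<^sup>2 + (vec_norm2 (B k - C k))\<^sup>2)"

text \<open>
  The law of a Xavier initialization: the entries of all weight matrices, indexed by
  (layer, row, column), are independent centered Gaussians, with standard deviation \<open>\<sigma> k\<close>
  in layer \<open>k\<close>. All statements about the initialization concern this law only, so the
  canonical probability space of entry families is used. An outcome \<open>z\<close> of the entries
  gives the initial parameters \<open>xavier_params n H d z\<close>, whose biases are 0.
\<close>

definition weight_entries :: "nat \<Rightarrow> nat \<Rightarrow> nat \<Rightarrow> (nat \<times> nat \<times> nat) set" where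
  "weight_entries n H d =
     (SIGMA k:{1..d}. {..<layer_rows H d k} \<times> {..<layer_cols n H k})"

definition xavier_measure ::
  "nat \<Rightarrow> nat \<Rightarrow> nat \<Rightarrow> (nat \<Rightarrow> real) \<Rightarrow> (nat \<times> nat \<times> nat \<Rightarrow> real) measure" where
  "xavier_measure n H d \<sigma> =
     (\<Pi>\<^sub>M (k, i, j) \<in> weight_entries n H d.
        density lborel (\<lambda>x. ennreal (normal_density 0 (\<sigma> k) x)))"

definition xavier_params :: "nat \<Rightarrow> nat \<Rightarrow> nat \<Rightarrow> (nat \<times> nat \<times> nat \<Rightarrow> real) \<Rightarrow> params" where
  "xavier_params n H d z =
     (\<lambda>k. Matrix.mat (layer_rows H d k) (layer_cols n H k) (\<lambda>(i, j). z (k, i, j)),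
      \<lambda>k. 0\<^sub>v (layer_rows H d k))"

definition xavier_std :: "real \<Rightarrow> real \<Rightarrow> nat \<Rightarrow> nat \<Rightarrow> (nat \<Rightarrow> real) \<Rightarrow> bool" where
  "xavier_std a\<^sub>1 a\<^sub>2 H d \<sigma> \<longleftrightarrow>
     (\<forall>k\<in>{1..d}. a\<^sub>1 / sqrt (real H) \<le> \<sigma> k \<and> \<sigma> k \<le> a\<^sub>2 / sqrt (real H))"

text \<open>
  Nonnegative quantities of order soft-O of 1, as functions of \<open>H\<close>, \<open>d\<close> and the failure
  probability \<open>\<delta>\<close>. Any product of powers of \<open>ln H\<close>, \<open>ln d\<close> and \<open>ln (1/\<delta>)\<close> is bounded by a
  power of \<open>1 + ln H + ln d + ln (1/\<delta>)\<close>, which is at least 1. A quantity is soft-O of \<open>X\<close> if it is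
  at most \<open>q * X\<close> for such a function \<open>q\<close>.
\<close>

definition soft_O_1 :: "(nat \<Rightarrow> nat \<Rightarrow> real \<Rightarrow> real) \<Rightarrow> bool" where
  "soft_O_1 f \<longleftrightarrow>
     (\<exists>C p. \<forall>H d \<delta>. H \<ge> 1 \<longrightarrow> d > 2 \<longrightarrow> 0 < \<delta> \<longrightarrow> \<delta> < 1 \<longrightarrow>
        0 \<le> f H d \<delta> \<and>
        f H d \<delta> \<le> C * (1 + ln (real H) + ln (real d) + ln (1 / \<delta>)) ^ (p :: nat))"

end

theory Submission
  imports Defs
begin

text \<open>
  Since \<open>\<parallel>W\<^sub>k\<parallel>\<^sub>2 \<le> \<parallel>Z\<^sub>k\<parallel>\<^sub>2 + \<parallel>W\<^sub>k - Z\<^sub>k\<parallel>\<^sub>F\<close>, it is enough that with high probability all \<open>\<parallel>Z\<^sub>k\<parallel>\<^sub>2\<close>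
  are bounded by some \<open>M\<close> polylogarithmic in \<open>H\<close>, \<open>d\<close> and \<open>1/\<delta>\<close>; then \<open>q = 1\<close> and \<open>c = 1 + M\<close> work.
  The points of the lattice of mesh \<open>1 / (2 sqrt l)\<close> in the unit ball of \<open>l\<close>-dimensional space form a
  \<open>1/2\<close>-net of at most \<open>48\<^sup>l\<close> points, and the spectral norm is at most 4 times the maximum of
  the bilinear form over two such nets. For fixed \<open>x\<close> and \<open>y\<close> in the unit balls the bilinear form of
  \<open>Z\<^sub>k\<close> is a linear form in independent Gaussians of variance at most \<open>a\<^sub>2\<^sup>2 / H\<close>, so by the Chernoff
  bound with exponent \<open>H\<close> it exceeds \<open>t\<close> with probability at most \<open>exp (H (a\<^sub>2\<^sup>2 / 2 - t))\<close>. As all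
  dimensions are at most \<open>n H\<close>, a union bound absorbs the net sizes into \<open>t\<close> at the cost of \<open>12 n\<close>.
\<close>

section \<open>Euclidean, Frobenius and spectral norms\<close>

lemma vec_norm2_eq: "v \<in> carrier_vec l \<Longrightarrow> vec_norm2 v = L2_set (vec_index v) {..<l}"
  by (auto simp: vec_norm2_def)

lemma vec_norm2_mult_mat_vec:
  assumes "A \<in> carrier_mat m l" "x \<in> carrier_vec l"
  shows "vec_norm2 (A *\<^sub>v x) = L2_set (\<lambda>i. \<Sum>j<l. A $$ (i, j) * vec_index x j) {..<m}"
  using assms
  by (auto simp: vec_norm2_def scalar_prod_def lessThan_atLeast0 intro!: L2_set_cong sum.cong)

lemma vec_norm2_nonneg: "0 \<le> vec_norm2 v"
  by (simp add: vec_norm2_def)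

lemma vec_norm2_smult: "vec_norm2 (a \<cdot>\<^sub>v v) = \<bar>a\<bar> * vec_norm2 v"
proof -
  have "vec_norm2 (a \<cdot>\<^sub>v v) = L2_set (\<lambda>i. a * vec_index v i) {..<dim_vec v}"
    by (auto simp: vec_norm2_def intro!: L2_set_cong)
  also have "\<dots> = sqrt (a\<^sup>2 * (\<Sum>i<dim_vec v. (vec_index v i)\<^sup>2))"
    by (simp add: L2_set_def power_mult_distrib sum_distrib_left)
  finally show ?thesis
    by (simp add: vec_norm2_def L2_set_def real_sqrt_mult)
qed

lemma vec_norm2_add_le:
  assumes "v \<in> carrier_vec l" "w \<in> carrier_vec l"
  shows "vec_norm2 (v + w) \<le> vec_norm2 v + vec_norm2 w"
proof -
  have "vec_norm2 (v + w) = L2_set (\<lambda>i. vec_index v i + vec_index w i) {..<l}"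
    using assms by (auto simp: vec_norm2_def intro!: L2_set_cong)
  then show ?thesis
    using assms L2_set_triangle_ineq[of "vec_index v" "vec_index w" "{..<l}"]
    by (simp add: vec_norm2_eq)
qed

lemma frobenius_norm_nonneg: "0 \<le> frobenius_norm A"
  by (simp add: frobenius_norm_def)

lemma abs_sum_le_L2_set: "\<bar>\<Sum>i\<in>I. f i * g i\<bar> \<le> L2_set f I * L2_set g I"
  using L2_set_mult_ineq[of f g I] sum_abs[of "\<lambda>i. f i * g i" I] by (simp add: abs_mult)

text \<open>Cauchy-Schwarz in each row, summed over the rows.\<close>

lemma vec_norm2_mult_le_frobenius_norm:
  assumes "A \<in> carrier_mat m l" "x \<in> carrier_vec l"
  shows "vec_norm2 (A *\<^sub>v x) \<le> frobenius_norm A * vec_norm2 x"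
proof -
  have "(\<Sum>i<m. (\<Sum>j<l. A $$ (i, j) * vec_index x j)\<^sup>2)
      \<le> (\<Sum>i<m. (\<Sum>j<l. (A $$ (i, j))\<^sup>2) * (\<Sum>j<l. (vec_index x j)\<^sup>2))"
  proof (rule sum_mono)
    fix i
    show "(\<Sum>j<l. A $$ (i, j) * vec_index x j)\<^sup>2
        \<le> (\<Sum>j<l. (A $$ (i, j))\<^sup>2) * (\<Sum>j<l. (vec_index x j)\<^sup>2)"
      by (rule Cauchy_Schwarz_ineq_sum)
  qed
  also have "\<dots> = (\<Sum>i<m. \<Sum>j<l. (A $$ (i, j))\<^sup>2) * (\<Sum>j<l. (vec_index x j)\<^sup>2)"
    by (simp add: sum_distrib_right)
  also have "(\<Sum>i<m. \<Sum>j<l. (A $$ (i, j))\<^sup>2) = (\<Sum>e\<in>{..<m} \<times> {..<l}. (A $$ e)\<^sup>2)"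
    by (simp add: sum.cartesian_product)
  finally have "sqrt (\<Sum>i<m. (\<Sum>j<l. A $$ (i, j) * vec_index x j)\<^sup>2)
      \<le> sqrt ((\<Sum>e\<in>{..<m} \<times> {..<l}. (A $$ e)\<^sup>2) * (\<Sum>j<l. (vec_index x j)\<^sup>2))"
    by simp
  then show ?thesis
    using assms by (simp add: vec_norm2_mult_mat_vec vec_norm2_eq frobenius_norm_def L2_set_def real_sqrt_mult)
qed

text \<open>A supremum of reals is sure to bound its members only if the set is bounded above; the
  Frobenius norm supplies that bound.\<close>

lemma spectral_norm_upper:
  assumes "A \<in> carrier_mat m l" "x \<in> carrier_vec l" "vec_norm2 x \<le> 1"
  shows "vec_norm2 (A *\<^sub>v x) \<le> spectral_norm A"
  unfolding spectral_norm_def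
proof (rule cSUP_upper)
  show "x \<in> {x \<in> carrier_vec (dim_col A). vec_norm2 x \<le> 1}"
    using assms by auto
  show "bdd_above ((\<lambda>x. vec_norm2 (A *\<^sub>v x)) ` {x \<in> carrier_vec (dim_col A). vec_norm2 x \<le> 1})"
  proof (rule bdd_aboveI2)
    fix y assume y: "y \<in> {x \<in> carrier_vec (dim_col A). vec_norm2 x \<le> 1}"
    then have "vec_norm2 (A *\<^sub>v y) \<le> frobenius_norm A * vec_norm2 y"
      using assms by (intro vec_norm2_mult_le_frobenius_norm) auto
    also have "\<dots> \<le> frobenius_norm A * 1"
      using y by (intro mult_left_mono frobenius_norm_nonneg) auto
    finally show "vec_norm2 (A *\<^sub>v y) \<le> frobenius_norm A" by simp
  qed
qed

lemma spectral_norm_least: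
  assumes "A \<in> carrier_mat m l"
    and "\<And>x. x \<in> carrier_vec l \<Longrightarrow> vec_norm2 x \<le> 1 \<Longrightarrow> vec_norm2 (A *\<^sub>v x) \<le> b"
  shows "spectral_norm A \<le> b"
  unfolding spectral_norm_def
proof (rule cSUP_least)
  have "0\<^sub>v (dim_col A) \<in> {x \<in> carrier_vec (dim_col A). vec_norm2 x \<le> 1}"
    by (auto simp: vec_norm2_def L2_set_def)
  then show "{x \<in> carrier_vec (dim_col A). vec_norm2 x \<le> 1} \<noteq> {}" by blast
qed (use assms in auto)

lemma spectral_norm_nonneg:
  assumes "A \<in> carrier_mat m l"
  shows "0 \<le> spectral_norm A"
proof -
  have "vec_norm2 (A *\<^sub>v 0\<^sub>v l) \<le> spectral_norm A"
    using assms by (intro spectral_norm_upper) (auto simp: vec_norm2_def L2_set_def)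
  then show ?thesis
    using vec_norm2_nonneg[of "A *\<^sub>v 0\<^sub>v l"] by linarith
qed

lemma spectral_norm_le_add_frobenius_norm:
  assumes W: "W \<in> carrier_mat m l" and Z: "Z \<in> carrier_mat m l"
  shows "spectral_norm W \<le> spectral_norm Z + frobenius_norm (W - Z)"
proof (rule spectral_norm_least[OF W])
  fix x :: "real Matrix.vec" assume x: "x \<in> carrier_vec l" "vec_norm2 x \<le> 1"
  have "W = Z + (W - Z)" using W Z by auto
  then have "W *\<^sub>v x = Z *\<^sub>v x + (W - Z) *\<^sub>v x"
    using W Z x add_mult_distrib_mat_vec[of Z m l "W - Z" x] by (metis minus_carrier_mat)
  then have "vec_norm2 (W *\<^sub>v x) \<le> vec_norm2 (Z *\<^sub>v x) + vec_norm2 ((W - Z) *\<^sub>v x)"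
    using W Z x vec_norm2_add_le[of "Z *\<^sub>v x" m "(W - Z) *\<^sub>v x"]
    by (metis minus_carrier_mat mult_mat_vec_carrier)
  also have "vec_norm2 ((W - Z) *\<^sub>v x) \<le> frobenius_norm (W - Z) * vec_norm2 x"
    using W Z x by (intro vec_norm2_mult_le_frobenius_norm) auto
  also have "\<dots> \<le> frobenius_norm (W - Z) * 1"
    using x by (intro mult_left_mono frobenius_norm_nonneg) auto
  finally show "vec_norm2 (W *\<^sub>v x) \<le> spectral_norm Z + frobenius_norm (W - Z)"
    using spectral_norm_upper[OF Z x] by simp
qed

section \<open>Lattice nets of the unit ball\<close>

text \<open>Integer coordinates of the net points: dividing by \<open>2 * sqrt l\<close> turns the
  squared radius \<open>4 * l\<close> into 1. Extensionality fixes the values off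
  \<open>{..<l}\<close>, without which the set would be infinite.\<close>

definition lattice_ball :: "nat \<Rightarrow> (nat \<Rightarrow> int) set" where
  "lattice_ball l = {k \<in> extensional {..<l}. (\<Sum>i<l. (k i)\<^sup>2) \<le> 4 * int l}"

definition ball_net :: "nat \<Rightarrow> (nat \<Rightarrow> real) set" where
  "ball_net l = (\<lambda>k i. of_int (k i) / (2 * sqrt (real l))) ` lattice_ball l"

text \<open>An integer is at most its square in absolute value, so the l1 norm inherits the bound on
  the squared Euclidean norm.\<close>

lemma lattice_ball_abs_le:
  assumes "k \<in> lattice_ball l"
  shows "(\<Sum>i<l. nat \<bar>k i\<bar>) \<le> 4 * l"
proof -
  have "\<bar>a\<bar> \<le> a\<^sup>2" for a :: int
    using self_le_power[of "\<bar>a\<bar>" 2] by (cases "a = 0") auto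
  then have "(\<Sum>i<l. \<bar>k i\<bar>) \<le> (\<Sum>i<l. (k i)\<^sup>2)"
    by (intro sum_mono)
  then have "int (\<Sum>i<l. nat \<bar>k i\<bar>) \<le> int (4 * l)"
    using assms by (simp add: lattice_ball_def)
  then show ?thesis by (simp only: of_nat_le_iff)
qed

text \<open>The enclosing box gives finiteness, and over it the weighted sum used for counting
  factors by coordinates.\<close>

lemma lattice_ball_subset: "lattice_ball l \<subseteq> {..<l} \<rightarrow>\<^sub>E {- int (4 * l)..int (4 * l)}"
proof
  fix k assume k: "k \<in> lattice_ball l"
  have "k i \<in> {- int (4 * l)..int (4 * l)}" if "i < l" for i
  proof -
    have "nat \<bar>k i\<bar> \<le> (\<Sum>i<l. nat \<bar>k i\<bar>)"
      using that by (intro member_le_sum) auto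
    then have "nat \<bar>k i\<bar> \<le> 4 * l" using lattice_ball_abs_le[OF k] by simp
    then show ?thesis by (simp add: nat_le_iff abs_le_iff)
  qed
  then show "k \<in> {..<l} \<rightarrow>\<^sub>E {- int (4 * l)..int (4 * l)}"
    using k by (auto simp: lattice_ball_def PiE_def Pi_def)
qed

lemma finite_lattice_ball: "finite (lattice_ball l)"
  by (rule finite_subset[OF lattice_ball_subset]) (intro finite_PiE; simp)

text \<open>Each induction step adds the two points of absolute value \<open>Suc N\<close>, hence
  \<open>2 * (1/2) ^ Suc N\<close>. What matters later is the bound 3, uniform in
  \<open>N\<close>.\<close>

lemma sum_half_power_abs: "(\<Sum>k\<in>{- int N..int N}. (1/2::real) ^ nat \<bar>k\<bar>) = 3 - 2 * (1/2) ^ N"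
proof (induction N)
  case (Suc N)
  have "{- int (Suc N)..int (Suc N)} = insert (int (Suc N)) (insert (- int (Suc N)) {- int N..int N})"
    by auto
  moreover have "nat (1 + int N) = Suc N" "nat (int N + 1) = Suc N" by simp_all
  ultimately show ?case using Suc by simp
qed simp

text \<open>Points are weighted by \<open>2\<close> to the minus their \<open>l\<^sub>1\<close> norm, so that the weights on the
  whole lattice have a bounded sum per coordinate.\<close>
lemma card_lattice_ball_le: "real (card (lattice_ball l)) \<le> 48 ^ l"
proof -
  let ?w = "\<lambda>k::int. (1/2::real) ^ nat \<bar>k\<bar>" and ?D = "{- int (4 * l)..int (4 * l)}"
  \<comment> \<open>Each point of the ball has weight at least \<open>(1/2) ^ (4 * l)\<close>, that
    is \<open>(1/16) ^ l\<close>, while the box weighs at most \<open>3 ^ l\<close>; the constant 48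
    is \<open>3 * 16\<close>.\<close>
  have "real (card (lattice_ball l)) * (1/16) ^ l = (\<Sum>k\<in>lattice_ball l. (1/2) ^ (4 * l))"
    by (simp add: power_mult power_divide)
  also have "\<dots> \<le> (\<Sum>k\<in>lattice_ball l. \<Prod>i<l. ?w (k i))"
  proof (rule sum_mono)
    fix k assume "k \<in> lattice_ball l"
    then have "(1/2::real) ^ (4 * l) \<le> (1/2) ^ (\<Sum>i<l. nat \<bar>k i\<bar>)"
      by (intro power_decreasing lattice_ball_abs_le) auto
    then show "(1/2) ^ (4 * l) \<le> (\<Prod>i<l. ?w (k i))"
      by (simp add: power_sum)
  qed
  also have "\<dots> \<le> (\<Sum>k\<in>{..<l} \<rightarrow>\<^sub>E ?D. \<Prod>i<l. ?w (k i))"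
    by (intro sum_mono2 lattice_ball_subset finite_PiE prod_nonneg) auto
  \<comment> \<open>Distributivity: the sum over all functions of a product over coordinates is a
    product of sums.\<close>
  also have "\<dots> = (\<Prod>i<l. \<Sum>k\<in>?D. ?w k)"
    by (rule prod_sum_PiE[symmetric]) auto
  also have "\<dots> \<le> (\<Prod>i<l. 3)"
  proof (intro prod_mono conjI)
    fix i
    have "(\<Sum>k\<in>?D. ?w k) = 3 - 2 * (1/2) ^ (4 * l)" by (rule sum_half_power_abs)
    moreover have "(0::real) < (1/2) ^ (4 * l)" by simp
    ultimately show "(\<Sum>k\<in>?D. ?w k) \<le> 3" by linarith
  qed (auto intro: sum_nonneg)
  finally have "real (card (lattice_ball l)) * (1/16) ^ l \<le> 3 ^ l" by simp
  then have "real (card (lattice_ball l)) \<le> 3 ^ l * 16 ^ l"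
    by (simp add: power_divide divide_simps mult.commute)
  then show ?thesis by (simp flip: power_mult_distrib)
qed

lemma finite_ball_net: "finite (ball_net l)"
  by (simp add: ball_net_def finite_lattice_ball)

lemma card_ball_net_le: "real (card (ball_net l)) \<le> 48 ^ l"
proof -
  have "real (card (ball_net l)) \<le> real (card (lattice_ball l))"
    unfolding ball_net_def by (intro of_nat_mono card_image_le finite_lattice_ball)
  then show ?thesis using card_lattice_ball_le[of l] by linarith
qed

lemma ball_net_sum_squares_le_1:
  assumes "x \<in> ball_net l"
  shows "(\<Sum>i<l. (x i)\<^sup>2) \<le> 1"
proof -
  obtain k where k: "k \<in> lattice_ball l" and x: "x = (\<lambda>i. of_int (k i) / (2 * sqrt (real l)))"
    using assms by (auto simp: ball_net_def)
  have "real_of_int (\<Sum>i<l. (k i)\<^sup>2) \<le> real_of_int (4 * int l)"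
    using k unfolding lattice_ball_def by (subst of_int_le_iff) simp
  moreover have "(\<Sum>i<l. (x i)\<^sup>2) = real_of_int (\<Sum>i<l. (k i)\<^sup>2) / (4 * real l)"
    by (simp add: x power_divide power_mult_distrib sum_divide_distrib)
  ultimately show ?thesis by (cases "l = 0") simp_all
qed

text \<open>Rounding \<open>r * u i\<close> to an integer, with \<open>r = 2 * sqrt l\<close>, moves
  each coordinate by at most \<open>1 / r\<close>, so the squared error is at most
  \<open>l / r\<^sup>2 = 1/4\<close>.\<close>

lemma ball_net_approx:
  assumes u: "L2_set u {..<l} \<le> 1"
  obtains x where "x \<in> ball_net l" "L2_set (\<lambda>i. u i - x i) {..<l} \<le> 1/2"
proof (cases "l = 0")
  case True
  \<comment> \<open>Over the empty index set every distance is 0, so any net point will do.\<close>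
  then have "ball_net l \<noteq> {}" by (auto simp: ball_net_def lattice_ball_def)
  then show ?thesis using True that by auto
next
  case False
  define r where "r = 2 * sqrt (real l)"
  have r: "r > 0" "r\<^sup>2 = 4 * real l"
    using False by (auto simp: r_def power_mult_distrib)
  \<comment> \<open>Rounding towards zero, so that the rounded point stays in the ball.\<close>
  define t where "t y = (if y \<ge> 0 then \<lfloor>y\<rfloor> else \<lceil>y\<rceil>)" for y :: real
  have t1: "\<bar>real_of_int (t y)\<bar> \<le> \<bar>y\<bar>" for y
  proof (cases "y \<ge> 0")
    case False
    then have "\<lceil>y\<rceil> \<le> 0" by simp
    then have "real_of_int \<lceil>y\<rceil> \<le> 0" by linarith
    then show ?thesis using False le_of_int_ceiling[of y] by (simp add: t_def)
  qed (simp add: t_def)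
  have t2: "\<bar>y - real_of_int (t y)\<bar> \<le> 1" for y
    unfolding t_def by (auto simp: abs_if) linarith+
  define k where "k = restrict (\<lambda>i. t (r * u i)) {..<l}"
  have su: "(\<Sum>i<l. (u i)\<^sup>2) \<le> 1"
    using u by (simp add: L2_set_def)
  have "real_of_int (\<Sum>i<l. (k i)\<^sup>2) \<le> (\<Sum>i<l. r\<^sup>2 * (u i)\<^sup>2)"
    unfolding of_int_sum
  proof (rule sum_mono)
    fix i assume "i \<in> {..<l}"
    then show "real_of_int ((k i)\<^sup>2) \<le> r\<^sup>2 * (u i)\<^sup>2"
      using t1[of "r * u i"] by (simp add: k_def abs_le_square_iff power_mult_distrib)
  qed
  also have "\<dots> = r\<^sup>2 * (\<Sum>i<l. (u i)\<^sup>2)" by (simp add: sum_distrib_left)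
  also have "\<dots> \<le> r\<^sup>2 * 1" by (intro mult_left_mono su) auto
  also have "\<dots> = real_of_int (4 * int l)" using r by simp
  finally have "(\<Sum>i<l. (k i)\<^sup>2) \<le> 4 * int l" by (simp only: of_int_le_iff)
  then have "k \<in> lattice_ball l" by (auto simp: lattice_ball_def k_def)
  then have mem: "(\<lambda>i. of_int (k i) / r) \<in> ball_net l"
    by (auto simp: ball_net_def r_def)
  have "(\<Sum>i<l. (u i - of_int (k i) / r)\<^sup>2) \<le> (\<Sum>i<l. 1 / r\<^sup>2)"
  proof (rule sum_mono)
    fix i assume "i \<in> {..<l}"
    then have "u i - of_int (k i) / r = (r * u i - of_int (t (r * u i))) / r"
      using r by (simp add: k_def field_simps)
    moreover have "(r * u i - of_int (t (r * u i)))\<^sup>2 \<le> 1"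
      using t2[of "r * u i"] by (simp add: abs_square_le_1)
    ultimately show "(u i - of_int (k i) / r)\<^sup>2 \<le> 1 / r\<^sup>2"
      by (simp add: power_divide divide_right_mono)
  qed
  also have "\<dots> = (1/2)\<^sup>2" using r False by (simp add: power2_eq_square)
  finally have "L2_set (\<lambda>i. u i - of_int (k i) / r) {..<l} \<le> 1/2"
    unfolding L2_set_def by (intro real_le_lsqrt) (auto intro: sum_nonneg)
  then show ?thesis using mem that by blast
qed

text \<open>With \<open>s\<close> the norm of \<open>w\<close> and \<open>x\<close> a net point
  within 1/2 of \<open>w / s\<close>, the identity \<open>s = <w / s, w>\<close> gives
  \<open>s \<le> T + s / 2\<close>.\<close>

lemma L2_set_le_of_ball_net:
  assumes "\<And>x. x \<in> ball_net m \<Longrightarrow> (\<Sum>i<m. x i * w i) \<le> T"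
  shows "L2_set w {..<m} \<le> 2 * T"
proof (cases "L2_set w {..<m} = 0")
  case True
  \<comment> \<open>The zero vector cannot be normalized; here any net point yields
    \<open>0 \<le> T\<close>.\<close>
  obtain x where "x \<in> ball_net m"
    using ball_net_approx[of "\<lambda>_. 0" m] by (auto simp: L2_set_def)
  moreover have "w i = 0" if "i < m" for i
    using True that by (simp add: L2_set_eq_0_iff)
  ultimately show ?thesis
    using assms[of x] True by simp
next
  case False
  define s where "s = L2_set w {..<m}"
  have s: "s > 0" using False L2_set_nonneg[of w "{..<m}"] by (simp add: s_def order_less_le)
  have ss: "(\<Sum>i<m. (w i)\<^sup>2) = s * s"
    by (simp add: s_def L2_set_def sum_nonneg)
  have "L2_set (\<lambda>i. w i / s) {..<m} \<le> 1"
    using s by (simp add: L2_set_def power_divide ss flip: sum_divide_distrib)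
      (simp add: power2_eq_square)
  then obtain x where x: "x \<in> ball_net m" "L2_set (\<lambda>i. w i / s - x i) {..<m} \<le> 1/2"
    by (rule ball_net_approx)
  have "s = (\<Sum>i<m. w i / s * w i)"
    using s ss by (simp add: power2_eq_square flip: sum_divide_distrib)
  also have "\<dots> = (\<Sum>i<m. x i * w i) + (\<Sum>i<m. (w i / s - x i) * w i)"
    by (simp add: algebra_simps flip: sum.distrib)
  also have "(\<Sum>i<m. (w i / s - x i) * w i) \<le> L2_set (\<lambda>i. w i / s - x i) {..<m} * s"
    using abs_sum_le_L2_set[of "\<lambda>i. w i / s - x i" w "{..<m}"] by (simp add: s_def)
  also have "\<dots> \<le> 1/2 * s" using x s by (intro mult_right_mono) auto
  finally show ?thesis using assms[OF x(1)] by (simp add: s_def)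
qed

text \<open>Replacing the left vector by a net point costs a factor 2 by duality. Replacing the
  right one leaves a residual of norm at most 1/2, so \<open>spectral_norm A\<close> is bounded by
  \<open>2 * T\<close> plus half of itself, which is absorbed.\<close>

lemma spectral_norm_le_of_ball_net:
  assumes A: "A \<in> carrier_mat m l"
    and T: "\<And>x y. x \<in> ball_net m \<Longrightarrow> y \<in> ball_net l \<Longrightarrow>
      (\<Sum>i<m. \<Sum>j<l. x i * y j * A $$ (i, j)) \<le> T"
  shows "spectral_norm A \<le> 4 * T"
proof -
  have "spectral_norm A \<le> 2 * T + spectral_norm A / 2"
  proof (rule spectral_norm_least[OF A])
    fix u :: "real Matrix.vec" assume u: "u \<in> carrier_vec l" "vec_norm2 u \<le> 1"
    then obtain y where y: "y \<in> ball_net l" "L2_set (\<lambda>i. vec_index u i - y i) {..<l} \<le> 1/2"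
      by (metis ball_net_approx vec_norm2_eq)
    define v where "v = Matrix.vec l y"
    have v: "v \<in> carrier_vec l" by (simp add: v_def)
    have "vec_norm2 (A *\<^sub>v v) \<le> 2 * T"
      unfolding vec_norm2_mult_mat_vec[OF A v]
    proof (rule L2_set_le_of_ball_net)
      fix x assume "x \<in> ball_net m"
      then show "(\<Sum>i<m. x i * (\<Sum>j<l. A $$ (i, j) * vec_index v j)) \<le> T"
        using T[OF _ y(1), of x] by (simp add: v_def sum_distrib_left mult_ac)
    qed
    \<comment> \<open>The doubled residual lies in the unit ball, so the spectral norm applies to
      it.\<close>
    moreover have "vec_norm2 (A *\<^sub>v (2 \<cdot>\<^sub>v (u - v))) \<le> spectral_norm A"
    proof (rule spectral_norm_upper[OF A])
      have "vec_norm2 (u - v) = L2_set (\<lambda>i. vec_index u i - y i) {..<l}"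
        using u v by (auto simp: vec_norm2_def v_def intro!: L2_set_cong)
      then show "vec_norm2 (2 \<cdot>\<^sub>v (u - v)) \<le> 1" using y by (simp add: vec_norm2_smult)
    qed (use u v in simp)
    moreover have "A *\<^sub>v (2 \<cdot>\<^sub>v (u - v)) = 2 \<cdot>\<^sub>v (A *\<^sub>v (u - v))"
      using A u v by (intro mult_mat_vec) auto
    moreover have "A *\<^sub>v u = A *\<^sub>v v + A *\<^sub>v (u - v)"
    proof -
      have "u = v + (u - v)" using u v by auto
      then show ?thesis
        using A u v by (metis minus_carrier_vec mult_add_distrib_mat_vec)
    qed
    moreover have "vec_norm2 (A *\<^sub>v v + A *\<^sub>v (u - v)) \<le> vec_norm2 (A *\<^sub>v v) + vec_norm2 (A *\<^sub>v (u - v))"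
      using A u v by (intro vec_norm2_add_le[of _ m]) auto
    ultimately show "vec_norm2 (A *\<^sub>v u) \<le> 2 * T + spectral_norm A / 2"
      by (simp add: vec_norm2_smult)
  qed
  then show ?thesis by simp
qed

section \<open>Chernoff bound for Gaussian linear forms\<close>

text \<open>Completing the square turns the integrand into a constant times the normal density with
  mean \<open>\<sigma>\<^sup>2 * c\<close>, whose integral is 1.\<close>

lemma nn_integral_exp_normal_density:
  assumes "\<sigma> > 0"
  shows "(\<integral>\<^sup>+x. ennreal (exp (c * x)) \<partial>density lborel (\<lambda>x. ennreal (normal_density 0 \<sigma> x)))
    = ennreal (exp (\<sigma>\<^sup>2 * c\<^sup>2 / 2))"
proof -
  have eq: "normal_density 0 \<sigma> x * exp (c * x) = exp (\<sigma>\<^sup>2 * c\<^sup>2 / 2) * normal_density (\<sigma>\<^sup>2 * c) \<sigma> x" for x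
  proof -
    have "- x\<^sup>2 / (2 * \<sigma>\<^sup>2) + c * x = \<sigma>\<^sup>2 * c\<^sup>2 / 2 + - (x - \<sigma>\<^sup>2 * c)\<^sup>2 / (2 * \<sigma>\<^sup>2)"
      using assms by (simp add: field_simps power2_eq_square)
    then show ?thesis
      by (simp add: normal_density_def mult_ac flip: exp_add)
  qed
  have "(\<integral>\<^sup>+x. ennreal (exp (c * x)) \<partial>density lborel (\<lambda>x. ennreal (normal_density 0 \<sigma> x)))
      = (\<integral>\<^sup>+x. ennreal (normal_density 0 \<sigma> x) * ennreal (exp (c * x)) \<partial>lborel)"
    by (rule nn_integral_density) auto
  also have "\<dots> = (\<integral>\<^sup>+x. ennreal (exp (\<sigma>\<^sup>2 * c\<^sup>2 / 2)) * ennreal (normal_density (\<sigma>\<^sup>2 * c) \<sigma> x) \<partial>lborel)"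
    by (simp add: eq flip: ennreal_mult)
  also have "\<dots> = ennreal (exp (\<sigma>\<^sup>2 * c\<^sup>2 / 2)) * (\<integral>\<^sup>+x. ennreal (normal_density (\<sigma>\<^sup>2 * c) \<sigma> x) \<partial>lborel)"
    by (rule nn_integral_cmult) auto
  also have "(\<integral>\<^sup>+x. ennreal (normal_density (\<sigma>\<^sup>2 * c) \<sigma> x) \<partial>lborel) = 1"
    using prob_space.emeasure_space_1[OF prob_space_normal_density[OF assms, of "\<sigma>\<^sup>2 * c"]]
    by (simp add: emeasure_density)
  finally show ?thesis by simp
qed

abbreviation gaussian_family :: "'i set \<Rightarrow> ('i \<Rightarrow> real) \<Rightarrow> ('i \<Rightarrow> real) measure" where
  "gaussian_family I s \<equiv> \<Pi>\<^sub>M e\<in>I. density lborel (\<lambda>x. ennreal (normal_density 0 (s e) x))"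

text \<open>Independence factors the moment generating function, which is taken at 1; other
  exponents are obtained by scaling \<open>c\<close> and \<open>t\<close>.\<close>

lemma prob_gaussian_family_linear_form_ge:
  assumes I: "finite I" and s: "\<And>e. s e > 0"
  shows "\<P>(z in gaussian_family I s. (\<Sum>e\<in>I. c e * z e) \<ge> t)
    \<le> exp ((\<Sum>e\<in>I. (s e)\<^sup>2 * (c e)\<^sup>2) / 2 - t)"
proof -
  let ?M = "\<lambda>e. density lborel (\<lambda>x. ennreal (normal_density 0 (s e) x))"
  interpret product_prob_space ?M I
    by (intro product_prob_spaceI) (simp add: s prob_space_normal_density)
  interpret P: prob_space "gaussian_family I s" by (rule prob_space_PiM) (simp add: s prob_space_normal_density)
  have [measurable]: "(\<lambda>z. \<Sum>e\<in>I. c e * z e) \<in> borel_measurable (gaussian_family I s)"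
    by measurable
  have "(\<integral>\<^sup>+z. ennreal (exp (\<Sum>e\<in>I. c e * z e)) \<partial>gaussian_family I s)
      = (\<integral>\<^sup>+z. (\<Prod>e\<in>I. ennreal (exp (c e * z e))) \<partial>gaussian_family I s)"
    using I by (simp add: exp_sum prod_ennreal)
  also have "\<dots> = (\<Prod>e\<in>I. \<integral>\<^sup>+x. ennreal (exp (c e * x)) \<partial>?M e)"
    using I by (intro product_nn_integral_prod) auto
  also have "\<dots> = (\<Prod>e\<in>I. ennreal (exp ((s e)\<^sup>2 * (c e)\<^sup>2 / 2)))"
    by (simp add: nn_integral_exp_normal_density s)
  also have "\<dots> = ennreal (exp ((\<Sum>e\<in>I. (s e)\<^sup>2 * (c e)\<^sup>2) / 2))"
    using I by (simp add: prod_ennreal sum_divide_distrib flip: exp_sum)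
  finally have mgf: "(\<integral>\<^sup>+z. ennreal (exp (\<Sum>e\<in>I. c e * z e)) \<partial>gaussian_family I s)
      = ennreal (exp ((\<Sum>e\<in>I. (s e)\<^sup>2 * (c e)\<^sup>2) / 2))" .
  \<comment> \<open>Markov's inequality: on the event, \<open>exp (- t)\<close> times the
    exponential of the form is at least 1.\<close>
  have "emeasure (gaussian_family I s) {z \<in> space (gaussian_family I s). (\<Sum>e\<in>I. c e * z e) \<ge> t}
      \<le> (\<integral>\<^sup>+z. ennreal (exp (- t)) * ennreal (exp (\<Sum>e\<in>I. c e * z e)) \<partial>gaussian_family I s)"
  proof (subst nn_integral_indicator[symmetric])
    show "{z \<in> space (gaussian_family I s). (\<Sum>e\<in>I. c e * z e) \<ge> t} \<in> sets (gaussian_family I s)"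
      by measurable
    show "(\<integral>\<^sup>+z. indicator {z \<in> space (gaussian_family I s). (\<Sum>e\<in>I. c e * z e) \<ge> t} z \<partial>gaussian_family I s)
      \<le> (\<integral>\<^sup>+z. ennreal (exp (- t)) * ennreal (exp (\<Sum>e\<in>I. c e * z e)) \<partial>gaussian_family I s)"
      by (intro nn_integral_mono)
        (auto simp: indicator_def simp flip: ennreal_mult exp_add ennreal_1 intro!: ennreal_leI)
  qed
  also have "\<dots> = ennreal (exp (- t)) * ennreal (exp ((\<Sum>e\<in>I. (s e)\<^sup>2 * (c e)\<^sup>2) / 2))"
    by (subst nn_integral_cmult) (auto simp: mgf)
  also have "\<dots> = ennreal (exp ((\<Sum>e\<in>I. (s e)\<^sup>2 * (c e)\<^sup>2) / 2 - t))"
    by (simp flip: ennreal_mult exp_add)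
  finally show ?thesis
    by (simp add: P.emeasure_eq_measure)
qed


section \<open>The Xavier law and the union bound over net points\<close>

lemma layer_rows_le: "n \<ge> 1 \<Longrightarrow> H \<ge> 1 \<Longrightarrow> layer_rows H d k \<le> n * H"
  by (auto simp: layer_rows_def)

lemma layer_cols_le: "n \<ge> 1 \<Longrightarrow> H \<ge> 1 \<Longrightarrow> layer_cols n H k \<le> n * H"
  by (auto simp: layer_cols_def)

lemma finite_weight_entries: "finite (weight_entries n H d)"
  by (auto simp: weight_entries_def)

lemma xavier_std_bounds:
  assumes "xavier_std a\<^sub>1 a\<^sub>2 H d \<sigma>" "0 < a\<^sub>1" "H \<ge> 1" "k \<in> {1..d}"
  shows "0 < \<sigma> k" "(\<sigma> k)\<^sup>2 \<le> a\<^sub>2\<^sup>2 / real H"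
proof -
  have le: "a\<^sub>1 / sqrt (real H) \<le> \<sigma> k" "\<sigma> k \<le> a\<^sub>2 / sqrt (real H)"
    using assms by (auto simp: xavier_std_def)
  moreover have "a\<^sub>1 / sqrt (real H) > 0" using assms by simp
  ultimately show "0 < \<sigma> k" by linarith
  then have "(\<sigma> k)\<^sup>2 \<le> (a\<^sub>2 / sqrt (real H))\<^sup>2"
    using le by (intro power_mono) auto
  then show "(\<sigma> k)\<^sup>2 \<le> a\<^sub>2\<^sup>2 / real H" by (simp add: power_divide)
qed

text \<open>The value 1 off the layers makes every factor a probability measure, even for indices
  outside the product, where \<open>\<sigma>\<close> is unconstrained.\<close>

lemma xavier_measure_eq_gaussian_family:
  "xavier_measure n H d \<sigma> = gaussian_family (weight_entries n H d)
    (\<lambda>e. if fst e \<in> {1..d} then \<sigma> (fst e) else 1)"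
  unfolding xavier_measure_def by (rule PiM_cong) (auto simp: weight_entries_def)

lemma prob_space_xavier_measure:
  assumes "xavier_std a\<^sub>1 a\<^sub>2 H d \<sigma>" "0 < a\<^sub>1" "H \<ge> 1"
  shows "prob_space (xavier_measure n H d \<sigma>)"
  unfolding xavier_measure_eq_gaussian_family
  by (rule prob_space_PiM) (use xavier_std_bounds[OF assms] in \<open>simp add: prob_space_normal_density\<close>)

lemma measurable_xavier_entry [measurable]:
  "e \<in> weight_entries n H d \<Longrightarrow> (\<lambda>z. z e) \<in> borel_measurable (xavier_measure n H d \<sigma>)"
  unfolding xavier_measure_eq_gaussian_family
  using measurable_component_singleton[of e "weight_entries n H d"
    "\<lambda>e. density lborel (\<lambda>x. ennreal (normal_density 0 (if fst e \<in> {1..d} then \<sigma> (fst e) else 1) x))"]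
  by simp

text \<open>Reduces sums over all entries of the network to one layer; it serves both the bilinear
  form and its variance.\<close>

lemma sum_weight_entries_layer:
  fixes f :: "nat \<Rightarrow> nat \<Rightarrow> real"
  assumes "k \<in> {1..d}"
  shows "(\<Sum>(k', i, j)\<in>weight_entries n H d. if k' = k then f i j else 0)
    = (\<Sum>i<layer_rows H d k. \<Sum>j<layer_cols n H k. f i j)"
proof -
  let ?S = "{..<layer_rows H d k} \<times> {..<layer_cols n H k}"
  have "(\<Sum>(k', i, j)\<in>weight_entries n H d. if k' = k then f i j else 0)
      = (\<Sum>(k', i, j)\<in>Pair k ` ?S. f i j)"
    using assms
    by (intro sum.mono_neutral_cong_right) (auto simp: weight_entries_def)
  also have "\<dots> = (\<Sum>(i, j)\<in>?S. f i j)"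
    by (subst sum.reindex) (auto simp: inj_on_def intro!: sum.cong)
  finally show ?thesis by (simp add: sum.cartesian_product)
qed

text \<open>Net points have norm at most 1, so the form has variance at most
  \<open>a\<^sub>2\<^sup>2 / H\<close>, and \<open>H\<close> times it has variance at most
  \<open>H * a\<^sub>2\<^sup>2\<close>.\<close>

lemma prob_xavier_bilinear_form_ge:
  assumes std: "xavier_std a\<^sub>1 a\<^sub>2 H d \<sigma>" "0 < a\<^sub>1" "H \<ge> 1" and k: "k \<in> {1..d}"
    and x: "x \<in> ball_net (layer_rows H d k)" and y: "y \<in> ball_net (layer_cols n H k)"
  shows "\<P>(z in xavier_measure n H d \<sigma>.
      (\<Sum>i<layer_rows H d k. \<Sum>j<layer_cols n H k. x i * y j * z (k, i, j)) \<ge> t)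
    \<le> exp (real H * (a\<^sub>2\<^sup>2 / 2 - t))"
proof -
  let ?I = "weight_entries n H d" and ?r = "layer_rows H d k" and ?c = "layer_cols n H k"
  define s where "s e = (if fst e \<in> {1..d} then \<sigma> (fst e) else 1)" for e :: "nat \<times> nat \<times> nat"
  \<comment> \<open>The factor \<open>real H\<close> is the Chernoff exponent, built into the
    coefficients; the threshold becomes \<open>real H * t\<close> accordingly.\<close>
  define c where "c = (\<lambda>(k', i, j). if k' = k then real H * (x i * y j) else 0)"
  have s: "s e > 0" for e
    using xavier_std_bounds[OF std] by (simp add: s_def)
  have H: "real H > 0" using std by simp
  have lin: "(\<Sum>e\<in>?I. c e * z e) = real H * (\<Sum>i<?r. \<Sum>j<?c. x i * y j * z (k, i, j))" for z
  proof -
    have "(\<Sum>e\<in>?I. c e * z e)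
        = (\<Sum>(k', i, j)\<in>?I. if k' = k then real H * (x i * y j * z (k, i, j)) else 0)"
      by (intro sum.cong) (auto simp: c_def)
    then show ?thesis by (simp add: sum_weight_entries_layer[OF k] sum_distrib_left)
  qed
  have "(\<Sum>e\<in>?I. (s e)\<^sup>2 * (c e)\<^sup>2)
      = (\<Sum>(k', i, j)\<in>?I. if k' = k then (\<sigma> k)\<^sup>2 * (real H)\<^sup>2 * ((x i)\<^sup>2 * (y j)\<^sup>2) else 0)"
    using k by (intro sum.cong) (auto simp: c_def s_def power_mult_distrib)
  also have "\<dots> = (\<sigma> k)\<^sup>2 * (real H)\<^sup>2 * ((\<Sum>i<?r. (x i)\<^sup>2) * (\<Sum>j<?c. (y j)\<^sup>2))"
    by (simp only: sum_weight_entries_layer[OF k] sum_product) (simp only: sum_distrib_left)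
  also have "\<dots> \<le> a\<^sub>2\<^sup>2 / real H * (real H)\<^sup>2 * (1 * 1)"
    by (intro mult_mono ball_net_sum_squares_le_1 x y xavier_std_bounds[OF std k])
      (auto intro!: sum_nonneg mult_nonneg_nonneg)
  also have "\<dots> = real H * a\<^sub>2\<^sup>2" using H by (simp add: power2_eq_square)
  finally have var: "(\<Sum>e\<in>?I. (s e)\<^sup>2 * (c e)\<^sup>2) \<le> real H * a\<^sub>2\<^sup>2" .
  have "\<P>(z in gaussian_family ?I s. (\<Sum>e\<in>?I. c e * z e) \<ge> real H * t)
      \<le> exp ((\<Sum>e\<in>?I. (s e)\<^sup>2 * (c e)\<^sup>2) / 2 - real H * t)"
    by (rule prob_gaussian_family_linear_form_ge[OF finite_weight_entries s])
  also have "\<dots> \<le> exp (real H * (a\<^sub>2\<^sup>2 / 2 - t))"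
    using var by (simp add: algebra_simps)
  finally show ?thesis
    unfolding lin using H by (simp add: xavier_measure_eq_gaussian_family s_def[abs_def])
qed

text \<open>Union bound over layers and pairs of net points. In the threshold,
  \<open>a\<^sub>2\<^sup>2 / 2\<close> cancels the variance term, \<open>12 * n\<close> pays for the
  two nets and the logarithm pays for the \<open>d\<close> layers and for
  \<open>\<delta>\<close>.\<close>

lemma prob_xavier_bilinear_forms_less:
  assumes std: "xavier_std a\<^sub>1 a\<^sub>2 H d \<sigma>" "0 < a\<^sub>1" "H \<ge> 1" and n: "n \<ge> 1" and d: "d \<ge> 1"
    and \<delta>: "0 < \<delta>" "\<delta> < 1"
  shows "\<P>(z in xavier_measure n H d \<sigma>. \<forall>k\<in>{1..d}.
      \<forall>x\<in>ball_net (layer_rows H d k). \<forall>y\<in>ball_net (layer_cols n H k).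
        (\<Sum>i<layer_rows H d k. \<Sum>j<layer_cols n H k. x i * y j * z (k, i, j))
          < a\<^sub>2\<^sup>2 / 2 + 12 * real n + ln (real d / \<delta>)) \<ge> 1 - \<delta>"
proof -
  let ?P = "xavier_measure n H d \<sigma>"
  let ?r = "layer_rows H d" and ?c = "layer_cols n H"
  define t where "t = a\<^sub>2\<^sup>2 / 2 + 12 * real n + ln (real d / \<delta>)"
  interpret P: prob_space ?P by (rule prob_space_xavier_measure[OF std])
  define J where "J = (SIGMA k:{1..d}. ball_net (?r k) \<times> ball_net (?c k))"
  define B where "B = (\<lambda>(k, x, y). {z \<in> space ?P. (\<Sum>i<?r k. \<Sum>j<?c k. x i * y j * z (k, i, j)) \<ge> t})"
  have finJ: "finite J" by (simp add: J_def finite_ball_net)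
  have Bsets: "B ` J \<subseteq> sets ?P"
  proof safe
    fix k x y assume "(k, x, y) \<in> J"
    then have [measurable]: "(\<lambda>z. z (k, i, j)) \<in> borel_measurable ?P" if "i < ?r k" "j < ?c k" for i j
      using that by (intro measurable_xavier_entry) (auto simp: J_def weight_entries_def)
    have "(\<lambda>z. \<Sum>i<?r k. \<Sum>j<?c k. x i * y j * z (k, i, j)) \<in> borel_measurable ?P"
      by (intro borel_measurable_sum borel_measurable_times) auto
    then show "B (k, x, y) \<in> sets ?P" unfolding B_def by simp
  qed
  \<comment> \<open>Turns the net size into an exponential: 48 is at most \<open>2 ^ 6\<close>. Two
    nets of dimension at most \<open>n * H\<close> then contribute the exponent
    \<open>12 * n * H\<close>.\<close>
  have e6: "(48::real) \<le> exp 6"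
  proof -
    have "(2::real) \<le> exp 1" using exp_ge_add_one_self[of 1] by simp
    then have "(2::real) ^ 6 \<le> exp 1 ^ 6" by (intro power_mono) auto
    then show ?thesis by (simp flip: exp_of_nat_mult)
  qed
  have card_net: "real (card (ball_net m)) \<le> exp (6 * real n * real H)" if "m \<le> n * H" for m
  proof -
    have "real (card (ball_net m)) \<le> 48 ^ m" by (rule card_ball_net_le)
    also have "\<dots> \<le> 48 ^ (n * H)" using that by (intro power_increasing) auto
    also have "\<dots> \<le> exp 6 ^ (n * H)" using e6 by (intro power_mono) auto
    finally show ?thesis by (simp add: mult_ac flip: exp_of_nat_mult)
  qed
  have "real (card J) = (\<Sum>k\<in>{1..d}. real (card (ball_net (?r k))) * real (card (ball_net (?c k))))"
    by (simp add: J_def card_SigmaI finite_ball_net)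
  also have "\<dots> \<le> (\<Sum>k\<in>{1..d}. exp (6 * real n * real H) * exp (6 * real n * real H))"
    using std n by (intro sum_mono mult_mono card_net layer_rows_le layer_cols_le) auto
  also have "\<dots> = real d * exp (12 * real n * real H)" by (simp flip: exp_add)
  finally have cardJ: "real (card J) \<le> real d * exp (12 * real n * real H)" .
  have "measure ?P (\<Union>j\<in>J. B j) \<le> (\<Sum>j\<in>J. measure ?P (B j))"
    by (rule P.finite_measure_subadditive_finite[OF finJ Bsets])
  also have "\<dots> \<le> (\<Sum>j\<in>J. exp (real H * (a\<^sub>2\<^sup>2 / 2 - t)))"
  proof (rule sum_mono)
    fix j assume "j \<in> J"
    then show "measure ?P (B j) \<le> exp (real H * (a\<^sub>2\<^sup>2 / 2 - t))"
      using prob_xavier_bilinear_form_ge[OF std] by (auto simp: J_def B_def)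
  qed
  also have "\<dots> = real (card J) * exp (real H * (a\<^sub>2\<^sup>2 / 2 - t))" by simp
  also have "\<dots> \<le> real d * exp (12 * real n * real H) * exp (real H * (a\<^sub>2\<^sup>2 / 2 - t))"
    by (intro mult_right_mono cardJ) auto
  also have "\<dots> = real d * exp (- (real H * ln (real d / \<delta>)))"
  proof -
    have "12 * real n * real H + real H * (a\<^sub>2\<^sup>2 / 2 - t) = - (real H * ln (real d / \<delta>))"
      by (simp add: t_def algebra_simps)
    then show ?thesis by (simp only: mult.assoc exp_add[symmetric])
  qed
  also have "\<dots> \<le> real d * exp (- ln (real d / \<delta>))"
  proof -
    have "real d / \<delta> \<ge> 1" using d \<delta> by (simp add: field_simps)
    then have "1 * ln (real d / \<delta>) \<le> real H * ln (real d / \<delta>)"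
      using std by (intro mult_right_mono) auto
    then show ?thesis by (intro mult_left_mono) auto
  qed
  also have "\<dots> = \<delta>" using d \<delta> by (simp add: exp_minus)
  finally have "measure ?P (\<Union>j\<in>J. B j) \<le> \<delta>" .
  moreover have "measure ?P (space ?P - (\<Union>j\<in>J. B j)) = 1 - measure ?P (\<Union>j\<in>J. B j)"
    using finJ Bsets by (intro P.prob_compl sets.finite_UN) auto
  moreover have "space ?P - (\<Union>j\<in>J. B j) = {z \<in> space ?P. \<forall>k\<in>{1..d}.
      \<forall>x\<in>ball_net (?r k). \<forall>y\<in>ball_net (?c k).
        (\<Sum>i<?r k. \<Sum>j<?c k. x i * y j * z (k, i, j)) < t}"
  proof -
    have "(z \<notin> (\<Union>j\<in>J. B j)) \<longleftrightarrow> (\<forall>(k, x, y)\<in>J. (\<Sum>i<?r k. \<Sum>j<?c k. x i * y j * z (k, i, j)) < t)"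
      if "z \<in> space ?P" for z
      using that by (simp add: B_def split_def not_le)
    then show ?thesis by (auto simp: J_def)
  qed
  ultimately show ?thesis by (simp add: t_def)
qed

section \<open>Measurability of the event\<close>

text \<open>Writes the distance as an explicit expression in the entries \<open>z\<close>, from
  which continuity in \<open>z\<close> can be read off.\<close>

lemma params_dist_xavier_params:
  assumes "(W, B) \<in> network_params n H d"
  shows "params_dist d (W, B) (xavier_params n H d z) =
    sqrt (\<Sum>k=1..d. (\<Sum>e\<in>{..<layer_rows H d k} \<times> {..<layer_cols n H k}. (W k $$ e - z (k, e))\<^sup>2)
      + (vec_norm2 (B k))\<^sup>2)"
proof -
  let ?Z = "\<lambda>k. Matrix.mat (layer_rows H d k) (layer_cols n H k) (\<lambda>(i, j). z (k, i, j))"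
  have "(frobenius_norm (W k - ?Z k))\<^sup>2 + (vec_norm2 (B k - 0\<^sub>v (layer_rows H d k)))\<^sup>2
    = (\<Sum>e\<in>{..<layer_rows H d k} \<times> {..<layer_cols n H k}. (W k $$ e - z (k, e))\<^sup>2) + (vec_norm2 (B k))\<^sup>2"
    if "k \<in> {1..d}" for k
  proof -
    have "W k \<in> carrier_mat (layer_rows H d k) (layer_cols n H k)" "B k \<in> carrier_vec (layer_rows H d k)"
      using assms that by (auto simp: network_params_def)
    moreover from this have "B k - 0\<^sub>v (layer_rows H d k) = B k" by auto
    ultimately show ?thesis
      by (auto simp: frobenius_norm_def L2_set_def sum_nonneg intro!: sum.cong)
  qed
  then show ?thesis
    unfolding xavier_params_def params_dist.simps by (intro arg_cong[where f = sqrt] sum.cong) auto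
qed

text \<open>The event is an uncountable intersection, but of closed conditions on the entries.\<close>
lemma sets_xavier_norm_bound:
  "{z \<in> space (xavier_measure n H d \<sigma>). \<forall>(W, B)\<in>network_params n H d.
      f W B \<le> q * (c * (1 + params_dist d (W, B) (xavier_params n H d z)) ^ m)}
    \<in> sets (xavier_measure n H d \<sigma>)"
proof -
  let ?P = "xavier_measure n H d \<sigma>" and ?I = "weight_entries n H d"
  define D where "D W B z =
    sqrt (\<Sum>k=1..d. (\<Sum>e\<in>{..<layer_rows H d k} \<times> {..<layer_cols n H k}. (W k $$ e - z (k, e))\<^sup>2)
      + (vec_norm2 (B k))\<^sup>2)" for W B and z :: "nat \<times> nat \<times> nat \<Rightarrow> real"
  define S where "S = {z. \<forall>(W, B)\<in>network_params n H d. f W B \<le> q * (c * (1 + D W B z) ^ m)}"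
  \<comment> \<open>Closedness lives in the space of all functions, whereas outcomes of the product
    measure are undefined off \<open>?I\<close>. Extending them by 0 is a measurable map between the
    two, and \<open>D\<close> does not see the change.\<close>
  define T where "T z = (\<lambda>e. if e \<in> ?I then z e else 0)" for z :: "nat \<times> nat \<times> nat \<Rightarrow> real"
  have "closed S"
  proof -
    have "S = (\<Inter>p\<in>network_params n H d. {z. f (fst p) (snd p) \<le> q * (c * (1 + D (fst p) (snd p) z) ^ m)})"
      by (simp add: S_def set_eq_iff split_def)
    moreover have "continuous_on UNIV (D W B)" for W B
      unfolding D_def by (intro continuous_intros continuous_on_product_coordinates)
    ultimately show ?thesis
      by (simp only:) (intro closed_INT ballI closed_Collect_le continuous_intros)
  qed
  \<comment> \<open>The index type is countable, so the product sigma-algebra is the Borel one and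
    contains closed sets.\<close>
  then have "S \<in> sets (Pi\<^sub>M UNIV (\<lambda>_. borel))"
    by (simp add: sets_PiM_equal_borel)
  moreover have "T \<in> measurable ?P (Pi\<^sub>M UNIV (\<lambda>_. borel))"
    unfolding T_def
  proof (rule measurable_PiM_single')
    fix e
    show "(\<lambda>z. if e \<in> ?I then z e else 0) \<in> borel_measurable ?P"
      by (cases "e \<in> ?I") auto
  qed auto
  ultimately have "T -` S \<inter> space ?P \<in> sets ?P"
    by (rule measurable_sets[rotated])
  moreover have DT: "D W B (T z) = D W B z" for W B z
    unfolding D_def T_def
    by (intro arg_cong[where f = sqrt] sum.cong arg_cong2[where f = "(+)"])
      (auto simp: weight_entries_def)
  moreover have "T -` S \<inter> space ?P = {z \<in> space ?P. \<forall>(W, B)\<in>network_params n H d.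
      f W B \<le> q * (c * (1 + params_dist d (W, B) (xavier_params n H d z)) ^ m)}"
  proof -
    have "T z \<in> S \<longleftrightarrow> (\<forall>(W, B)\<in>network_params n H d.
        f W B \<le> q * (c * (1 + params_dist d (W, B) (xavier_params n H d z)) ^ m))" for z
      unfolding S_def mem_Collect_eq DT
    proof (intro ball_cong refl, clarify)
      fix W B assume "(W, B) \<in> network_params n H d"
      then have "params_dist d (W, B) (xavier_params n H d z) = D W B z"
        unfolding D_def by (rule params_dist_xavier_params)
      then show "f W B \<le> q * (c * (1 + D W B z) ^ m) \<longleftrightarrow>
          f W B \<le> q * (c * (1 + params_dist d (W, B) (xavier_params n H d z)) ^ m)"
        by (simp only:)
    qed
    then show ?thesis by blast
  qed
  ultimately show ?thesis by simp
qed

section \<open>Deterministic product bound, soft-O estimates and conclusion\<close>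

text \<open>The deviation of a single layer is at most the whole distance, so every factor is at
  most \<open>M + ?D\<close>.\<close>

lemma prod_spectral_norm_le:
  assumes WB: "(W, B) \<in> network_params n H d" and Z: "(Z, C) \<in> network_params n H d"
    and M: "0 \<le> M" "\<And>k. k \<in> {1..d} \<Longrightarrow> spectral_norm (Z k) \<le> M"
  shows "(\<Prod>k=1..d. spectral_norm (W k)) \<le> (1 + M) ^ d * (1 + params_dist d (W, B) (Z, C)) ^ d"
proof -
  let ?D = "params_dist d (W, B) (Z, C)"
  have "(\<Prod>k=1..d. spectral_norm (W k)) \<le> (\<Prod>k=1..d. (1 + M) * (1 + ?D))"
  proof (rule prod_mono)
    fix k assume k: "k \<in> {1..d}"
    then have W: "W k \<in> carrier_mat (layer_rows H d k) (layer_cols n H k)"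
      and Zk: "Z k \<in> carrier_mat (layer_rows H d k) (layer_cols n H k)"
      using WB Z by (auto simp: network_params_def)
    let ?g = "\<lambda>k. (frobenius_norm (W k - Z k))\<^sup>2 + (vec_norm2 (B k - C k))\<^sup>2"
    have "?g k \<le> (\<Sum>k=1..d. ?g k)"
      using k by (intro member_le_sum) auto
    then have "(frobenius_norm (W k - Z k))\<^sup>2 \<le> (\<Sum>k=1..d. ?g k)"
      using zero_le_power2[of "vec_norm2 (B k - C k)"] by linarith
    then have "frobenius_norm (W k - Z k) \<le> ?D"
      by (simp add: real_le_rsqrt)
    then have "spectral_norm (W k) \<le> M + ?D"
      using spectral_norm_le_add_frobenius_norm[OF W Zk] M(2)[OF k] by linarith
    \<comment> \<open>Passing to a product of two factors separates the two \<open>d\<close>-th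
      powers.\<close>
    also have "\<dots> \<le> (1 + M) * (1 + ?D)"
    proof -
      have "0 \<le> ?D" by (simp add: sum_nonneg)
      then have "0 \<le> M * ?D" using M by simp
      then show ?thesis by (simp add: distrib_left distrib_right)
    qed
    finally show "0 \<le> spectral_norm (W k) \<and> spectral_norm (W k) \<le> (1 + M) * (1 + ?D)"
      using spectral_norm_nonneg[OF W] by simp
  qed
  then show ?thesis by (simp add: power_mult_distrib)
qed

lemma soft_O_1_const: "0 \<le> a \<Longrightarrow> soft_O_1 (\<lambda>_ _ _. a)"
  unfolding soft_O_1_def by (rule exI[of _ a], rule exI[of _ 0]) simp

text \<open>With \<open>L\<close> the polylogarithmic base, \<open>1 \<le> L\<close> and
  \<open>ln (d / \<delta>) \<le> L\<close>, so the power 1 and the constant \<open>a + b\<close>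
  suffice.\<close>

lemma soft_O_1_add_ln:
  assumes "0 \<le> a" "0 \<le> b"
  shows "soft_O_1 (\<lambda>H d \<delta>. a + b * ln (real d / \<delta>))"
  unfolding soft_O_1_def
proof (intro exI[of _ "a + b"] exI[of _ "1::nat"] allI impI)
  fix H d :: nat and \<delta> :: real
  assume h: "H \<ge> 1" "d > 2" "0 < \<delta>" "\<delta> < 1"
  define L where "L = 1 + ln (real H) + ln (real d) + ln (1 / \<delta>)"
  have ln: "ln (real H) \<ge> 0" "ln (real d) \<ge> 0" "ln (1 / \<delta>) \<ge> 0"
    using h by auto
  have eq: "ln (real d / \<delta>) = ln (real d) + ln (1 / \<delta>)"
    using h by (simp add: ln_div)
  have "a * 1 \<le> a * L" "b * ln (real d / \<delta>) \<le> b * L"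
    unfolding eq using ln assms by (intro mult_left_mono; simp add: L_def)+
  then show "0 \<le> a + b * ln (real d / \<delta>) \<and> a + b * ln (real d / \<delta>)
      \<le> (a + b) * (1 + ln (real H) + ln (real d) + ln (1 / \<delta>)) ^ 1"
    using ln assms unfolding L_def[symmetric] eq by (simp add: distrib_right)
qed

theorem proposition6p2:
  fixes n :: nat and a\<^sub>1 a\<^sub>2 :: real
  assumes "n \<ge> 1" and "0 < a\<^sub>1" and "a\<^sub>1 \<le> a\<^sub>2"
  shows "\<exists>q c :: nat \<Rightarrow> nat \<Rightarrow> real \<Rightarrow> real.
    soft_O_1 q \<and> soft_O_1 c \<and>
    (\<forall>(H::nat) (d::nat) (\<delta>::real) (\<sigma> :: nat \<Rightarrow> real).
       H \<ge> 1 \<longrightarrow> d > 2 \<longrightarrow> 0 < \<delta> \<longrightarrow> \<delta> < 1 \<longrightarrow> xavier_std a\<^sub>1 a\<^sub>2 H d \<sigma> \<longrightarrow>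
       \<P>(z in xavier_measure n H d \<sigma>.
          \<forall>(W, B) \<in> network_params n H d.
            (\<Prod>k=1..d. spectral_norm (W k))
              \<le> q H d \<delta> * (c H d \<delta> ^ d * (1 + params_dist d (W, B) (xavier_params n H d z)) ^ d))
       \<ge> 1 - \<delta>)"
proof -
  define t where "t d \<delta> = a\<^sub>2\<^sup>2 / 2 + 12 * real n + ln (real d / \<delta>)" for d and \<delta> :: real
  \<comment> \<open>This is \<open>1 + M\<close> with \<open>M = 4 * t d \<delta>\<close>, where 4
    is the loss in passing from the nets to the spectral norm.\<close>
  define c where "c = (\<lambda>(H::nat) (d::nat) (\<delta>::real). 1 + 4 * t d \<delta>)"
  have "soft_O_1 (\<lambda>H d \<delta>. (1 + 2 * a\<^sub>2\<^sup>2 + 48 * real n) + 4 * ln (real d / \<delta>))"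
    by (rule soft_O_1_add_ln) auto
  then have c: "soft_O_1 c"
    by (simp add: c_def t_def algebra_simps)
  have event: "\<P>(z in xavier_measure n H d \<sigma>. \<forall>(W, B) \<in> network_params n H d.
        (\<Prod>k=1..d. spectral_norm (W k))
          \<le> 1 * (c H d \<delta> ^ d * (1 + params_dist d (W, B) (xavier_params n H d z)) ^ d)) \<ge> 1 - \<delta>"
    if h: "H \<ge> 1" "d > 2" "0 < \<delta>" "\<delta> < 1" and std: "xavier_std a\<^sub>1 a\<^sub>2 H d \<sigma>" for H d \<delta> \<sigma>
  proof -
    let ?P = "xavier_measure n H d \<sigma>"
    interpret P: prob_space ?P using std assms(2) h(1) by (rule prob_space_xavier_measure)
    have t0: "0 \<le> t d \<delta>"
    proof -
      have "real d / \<delta> \<ge> 1" using h by (simp add: field_simps)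
      then show ?thesis by (simp add: t_def)
    qed
    have "1 - \<delta> \<le> \<P>(z in ?P. \<forall>k\<in>{1..d}.
        \<forall>x\<in>ball_net (layer_rows H d k). \<forall>y\<in>ball_net (layer_cols n H k).
          (\<Sum>i<layer_rows H d k. \<Sum>j<layer_cols n H k. x i * y j * z (k, i, j)) < t d \<delta>)"
      unfolding t_def using std assms h by (intro prob_xavier_bilinear_forms_less) auto
    \<comment> \<open>Inclusion of events; monotonicity of the measure requires the larger event to
      be measurable.\<close>
    also have "\<dots> \<le> \<P>(z in ?P. \<forall>(W, B) \<in> network_params n H d.
        (\<Prod>k=1..d. spectral_norm (W k))
          \<le> 1 * (c H d \<delta> ^ d * (1 + params_dist d (W, B) (xavier_params n H d z)) ^ d))"
    proof (rule P.finite_measure_mono[OF _ sets_xavier_norm_bound], intro subsetI CollectI conjI ballI)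
      fix z assume z: "z \<in> {z \<in> space ?P. \<forall>k\<in>{1..d}.
        \<forall>x\<in>ball_net (layer_rows H d k). \<forall>y\<in>ball_net (layer_cols n H k).
          (\<Sum>i<layer_rows H d k. \<Sum>j<layer_cols n H k. x i * y j * z (k, i, j)) < t d \<delta>}"
      then show "z \<in> space ?P" by simp
      obtain Z C where ZC: "xavier_params n H d z = (Z, C)" by fastforce
      then have Z: "Z k = Matrix.mat (layer_rows H d k) (layer_cols n H k) (\<lambda>(i, j). z (k, i, j))" for k
        by (auto simp: xavier_params_def)
      have "(Z, C) \<in> network_params n H d"
        using ZC by (auto simp: xavier_params_def network_params_def)
      moreover have "spectral_norm (Z k) \<le> 4 * t d \<delta>" if "k \<in> {1..d}" for k
      proof (rule spectral_norm_le_of_ball_net)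
        show "Z k \<in> carrier_mat (layer_rows H d k) (layer_cols n H k)" by (simp add: Z)
        fix x y assume "x \<in> ball_net (layer_rows H d k)" "y \<in> ball_net (layer_cols n H k)"
        then show "(\<Sum>i<layer_rows H d k. \<Sum>j<layer_cols n H k. x i * y j * Z k $$ (i, j)) \<le> t d \<delta>"
          using z that by (auto simp: Z intro!: less_imp_le)
      qed
      ultimately show "case p of (W, B) \<Rightarrow> (\<Prod>k=1..d. spectral_norm (W k))
          \<le> 1 * (c H d \<delta> ^ d * (1 + params_dist d (W, B) (xavier_params n H d z)) ^ d)"
        if "p \<in> network_params n H d" for p
        using prod_spectral_norm_le[of "fst p" "snd p" n H d Z C "4 * t d \<delta>"] that t0
        by (auto simp: ZC c_def simp del: params_dist.simps)
    qed
    finally show ?thesis .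
  qed
  have "soft_O_1 (\<lambda>_ _ _. 1)" by (rule soft_O_1_const) simp
  with c show ?thesis
    by (intro exI[of _ "\<lambda>_ _ _. 1"] exI[of _ c] conjI allI impI event)
qed

end
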